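(* Let $\lambda$ be a nonzero real number. For $j=0,1,2,\dots$ and $N=1,2,3,\dots$, $$b_{j+N,\lambda}=\sum_{l=-N}^j\sum_{i=\max\{0,-l\}}^N(-1)^{N+j+l}\binom{N+j-l-1}{j-l}a_{i,\lambda}(N)\,b^{(i+1)}_{l+i,\lambda}\frac{j!}{(l+i)!}$$ $$+\sum_{l=-N}^j\sum_{i=\max\{0,-l-1\}}^{N-1}N(-1)^{N+j+l+1}\binom{N+j-l-1}{j-l}a_{i,\lambda}(N-1)\,b^{(i+1)}_{l+i+1,\lambda}\frac{j!}{(l+i+1)!}$$ $$+\sum_{l=-(N-1)}^j\sum_{i=\max\{0,-l\}}^{N-1}N(-1)^{N+j+l+1}\binom{N+j-l-1}{j-l}a_{i,\lambda}(N-1)\,b^{(i+1)}_{l+i,\lambda}\frac{j!}{(l+i)!}.$$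
   Context: For a positive integer $r$, the degenerate Bernoulli numbers of the second kind of order $r$ are defined by $\left(\frac{\lambda t}{(1+t)^\lambda-1}\right)^r=\sum_{n=0}^\infty b^{(r)}_{n,\lambda}\frac{t^n}{n!}$, and $b_{n,\lambda}=b^{(1)}_{n,\lambda}$. Let $F(t)=\frac{\lambda}{(1+t)^\lambda-1}$. For $N\ge1$ the numbers $a_{i,\lambda}(N)$, $0\le i\le N$, are the coefficients with $F^{(N)}(t)=\left(\frac{-1}{1+t}\right)^N\sum_{i=0}^N a_{i,\lambda}(N)F(t)^{i+1}$ ($F^{(N)}$ the $N$-th derivative in $t$), and $a_{0,\lambda}(0)=1$ (consistent with $F^{(0)}=F$). *)

theory Defs
  imports "HOL-Computational_Algebra.Computational_Algebra"
begin

text \<open>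
  All generating functions are read as formal series in \<open>t\<close> over the reals, where
  \<open>fps_binomial lam\<close>, with \<open>lam\<close> for \<open>\<lambda>\<close>, is the binomial series \<open>(1 + t)\<^sup>\<lambda>\<close>.
\<close>

text \<open>
  For \<open>lam \<noteq> 0\<close> numerator and denominator both vanish to order exactly one at \<open>t = 0\<close>, so the
  division of formal power series below is exact (see \<open>degenerate_bernoulli2_base\<close>).
\<close>

definition degenerate_bernoulli2 :: "real \<Rightarrow> nat \<Rightarrow> nat \<Rightarrow> real" where
  "degenerate_bernoulli2 lam r n =
     fact n * fps_nth ((fps_const lam * fps_X / (fps_binomial lam - 1)) ^ r) n"

text \<open>\<open>F(t)\<close> has a simple pole at \<open>t = 0\<close>, hence it is a formal Laurent series.\<close>

definition F_series :: "real \<Rightarrow> real fls" where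
  "F_series lam = fls_const lam / (fps_to_fls (fps_binomial lam) - 1)"

definition is_F_deriv_coeffs :: "real \<Rightarrow> nat \<Rightarrow> (nat \<Rightarrow> real) \<Rightarrow> bool" where
  "is_F_deriv_coeffs lam N c \<longleftrightarrow>
     (\<forall>i>N. c i = 0) \<and>
     (fls_deriv ^^ N) (F_series lam) =
       (- 1 / (1 + fls_X)) ^ N * (\<Sum>i=0..N. fls_const (c i) * F_series lam ^ (i + 1))"

text \<open>
  The coefficients \<open>a\<^sub>i\<^sub>,\<^sub>\<lambda>(N)\<close>. They exist and are unique for \<open>lam \<noteq> 0\<close> (lemma
  \<open>ex1_F_deriv_coeffs\<close>); the case \<open>N = 0\<close> yields \<open>a\<^sub>0\<^sub>,\<^sub>\<lambda>(0) = 1\<close> (lemma \<open>a_coeff_0_0\<close>).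
\<close>

definition a_coeff :: "real \<Rightarrow> nat \<Rightarrow> nat \<Rightarrow> real" where
  "a_coeff lam N = (THE c. is_F_deriv_coeffs lam N c)"

lemma degenerate_bernoulli2_base:
  assumes "lam \<noteq> 0"
  shows "fps_const lam * fps_X / (fps_binomial lam - 1) * (fps_binomial lam - 1) = fps_const lam * fps_X"
proof -
  have "subdegree (fps_binomial lam - 1) = 1"
    using assms by (intro subdegreeI) auto
  moreover have "subdegree (fps_const lam * fps_X) = 1"
    using assms by simp
  moreover have "fps_binomial lam - 1 \<noteq> 0"
    using calculation by fastforce
  ultimately have "(fps_binomial lam - 1) dvd (fps_const lam * fps_X)"
    by (subst fps_dvd_iff) (use assms in auto)
  thus ?thesis by simp
qed

lemma binomial_series_minus_1_nonzero:
  assumes "lam \<noteq> 0"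
  shows "fps_to_fls (fps_binomial lam) - 1 \<noteq> 0"
proof
  assume "fps_to_fls (fps_binomial lam) - 1 = 0"
  hence "fls_nth (fps_to_fls (fps_binomial lam) - 1) 1 = 0" by simp
  thus False using assms by simp
qed

lemma fls_subdegree_F_series:
  assumes "lam \<noteq> 0"
  shows "fls_subdegree (F_series lam) = - 1"
proof -
  have "fls_subdegree (fps_to_fls (fps_binomial lam) - 1) = 1"
    using assms by (intro fls_subdegree_eqI) (auto simp: not_less)
  thus ?thesis using assms binomial_series_minus_1_nonzero[OF assms]
    by (simp add: F_series_def fls_divide_subdegree)
qed

lemma F_series_nonzero:
  assumes "lam \<noteq> 0"
  shows "F_series lam \<noteq> 0"
  using fls_subdegree_F_series[OF assms] by auto

lemma one_plus_fls_X_nonzero: "(1 + fls_X :: real fls) \<noteq> 0"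
proof
  assume "(1 + fls_X :: real fls) = 0"
  hence "fls_nth (1 + fls_X :: real fls) 0 = 0" by simp
  thus False by simp
qed

lemma fls_deriv_F_series:
  assumes "lam \<noteq> 0"
  shows "(1 + fls_X) * fls_deriv (F_series lam) =
           - (fls_const lam * F_series lam + F_series lam ^ 2)"
proof -
  define G where "G = fps_to_fls (fps_binomial lam)"
  define F where "F = F_series lam"
  have nz: "G - 1 \<noteq> 0"
    using binomial_series_minus_1_nonzero[OF assms] by (simp add: G_def)
  have FG: "F * (G - 1) = fls_const lam"
    using nz by (simp add: F_def F_series_def G_def)
  have "(1 + fps_X) * fps_deriv (fps_binomial lam) = fps_const lam * fps_binomial lam"
    by (simp add: fps_binomial_deriv fps_divide_unit mult.commute[of _ "inverse _"])
      (simp add: inverse_mult_eq_1)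
  hence "fps_to_fls ((1 + fps_X) * fps_deriv (fps_binomial lam)) =
      fps_to_fls (fps_const lam * fps_binomial lam)" by simp
  hence dG: "(1 + fls_X) * fls_deriv G = fls_const lam * G"
    by (simp add: G_def fls_times_fps_to_fls fls_deriv_fps_to_fls)
  have "fls_deriv (F * (G - 1)) = 0" by (simp add: FG)
  hence "fls_deriv F * (G - 1) = - (F * fls_deriv G)"
    by (simp add: eq_neg_iff_add_eq_0 add.commute)
  hence "(1 + fls_X) * (fls_deriv F * (G - 1)) = (1 + fls_X) * - (F * fls_deriv G)" by simp
  hence "(1 + fls_X) * fls_deriv F * (G - 1) = - (F * ((1 + fls_X) * fls_deriv G))"
    by (simp only: mult_minus_right mult_ac)
  also have "\<dots> = - (F * (F * (G - 1) * G))" by (simp add: dG FG)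
  also have "\<dots> = - (F ^ 2 + F * (F * (G - 1))) * (G - 1)"
    by (simp add: algebra_simps power2_eq_square)
  also have "F * (F * (G - 1)) = fls_const lam * F" by (simp add: FG mult.commute)
  finally show ?thesis using nz by (simp add: F_def add.commute)
qed

lemma F_series_powers_independent:
  assumes "lam \<noteq> 0" and "(\<Sum>i=0..N. fls_const (c i) * F_series lam ^ (i + 1)) = 0" and "i \<le> N"
  shows "c i = 0"
  using assms(2,3)
proof (induction N arbitrary: i)
  case (0 i)
  thus ?case using F_series_nonzero[OF assms(1)] by simp
next
  case (Suc N i)
  have low: "fls_nth (F_series lam ^ (k + 1)) (- int (Suc N + 1)) = 0" if "k \<le> N" for k
    using that by (intro fls_eq0_below_subdegree)
      (simp only: fls_subdegree_pow fls_subdegree_F_series[OF assms(1)], simp)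
  have "fls_nth (F_series lam ^ (Suc N + 1)) (fls_subdegree (F_series lam ^ (Suc N + 1))) \<noteq> 0"
    using F_series_nonzero[OF assms(1)] by (intro nth_fls_subdegree_nonzero) simp
  hence top: "fls_nth (F_series lam ^ (Suc N + 1)) (- int (Suc N + 1)) \<noteq> 0"
    unfolding fls_subdegree_pow fls_subdegree_F_series[OF assms(1)] by simp
  have "0 = fls_nth (\<Sum>k=0..Suc N. fls_const (c k) * F_series lam ^ (k + 1)) (- int (Suc N + 1))"
    using Suc.prems(1) by simp
  also have "\<dots> = (\<Sum>k=0..Suc N. c k * fls_nth (F_series lam ^ (k + 1)) (- int (Suc N + 1)))"
    by (simp only: fls_nth_sum fls_mult_const_nth(1))
  also have "\<dots> = c (Suc N) * fls_nth (F_series lam ^ (Suc N + 1)) (- int (Suc N + 1))"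
    using low by (simp del: power_Suc add: sum.neutral)
  finally have z: "c (Suc N) = 0" using top by simp
  hence "(\<Sum>i=0..N. fls_const (c i) * F_series lam ^ (i + 1)) = 0" using Suc.prems(1) by simp
  from Suc.IH[OF this] z Suc.prems(2) show ?case by (cases "i = Suc N") auto
qed

lemma ex_F_deriv_coeffs:
  assumes "lam \<noteq> 0"
  shows "\<exists>c. is_F_deriv_coeffs lam N c"
proof (induction N)
  case 0
  have "is_F_deriv_coeffs lam 0 (\<lambda>i. if i = 0 then 1 else 0)"
    by (simp add: is_F_deriv_coeffs_def)
  thus ?case by blast
next
  case (Suc N)
  then obtain c where c: "is_F_deriv_coeffs lam N c" by blast
  define U :: "real fls" where "U = - 1 / (1 + fls_X)"
  define F where "F = F_series lam"
  define S where "S = (\<Sum>i=0..N. fls_const (c i) * F ^ (i + 1))"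
  define d where
    "d = (\<lambda>i. (if i = 0 then 0 else real i * c (i - 1)) + (real N + real (i + 1) * lam) * c i)"
  have U1: "U * (1 + fls_X) = - 1"
    using one_plus_fls_X_nonzero by (simp add: U_def)
  have "U * ((1 + fls_X) * fls_deriv F) = - (U * (fls_const lam * F + F ^ 2))"
    by (simp only: F_def fls_deriv_F_series[OF assms] mult_minus_right)
  hence dF: "fls_deriv F = U * (fls_const lam * F + F ^ 2)"
    using U1 by (simp flip: mult.assoc)
  have "fls_deriv (U * (1 + fls_X)) = 0" by (simp add: U1)
  hence "fls_deriv U * (1 + fls_X) = - U" by (simp add: eq_neg_iff_add_eq_0 add.commute)
  hence "U * (fls_deriv U * (1 + fls_X)) = - (U ^ 2)" by (simp add: power2_eq_square)
  moreover have "U * (fls_deriv U * (1 + fls_X)) = fls_deriv U * (U * (1 + fls_X))"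
    by (simp add: mult_ac)
  ultimately have dU: "fls_deriv U = U ^ 2" by (simp add: U1)
  have dUN: "fls_deriv (U ^ N) = of_nat N * U ^ (N + 1)"
    unfolding fls_deriv_power dU by (cases N) (simp_all add: power2_eq_square mult_ac)
  have "fls_deriv S = (\<Sum>i=0..N. fls_const (c i) * (of_nat (i + 1) * F ^ i * fls_deriv F))"
    by (simp add: S_def fls_deriv_sum fls_deriv_power mult_ac del: power_Suc of_nat_Suc)
  also have "\<dots> = U * (\<Sum>i=0..N. fls_const (c i) * of_nat (i + 1) *
      (fls_const lam * F ^ (i + 1) + F ^ (i + 2)))"
    by (simp add: dF sum_distrib_left algebra_simps power2_eq_square)
  finally have dS: "fls_deriv S = U * (\<Sum>i=0..N. fls_const (c i) * of_nat (i + 1) *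
      (fls_const lam * F ^ (i + 1) + F ^ (i + 2)))" .
  have c_top: "c (Suc N) = 0" using c by (simp add: is_F_deriv_coeffs_def)
  have cst: "of_nat k = fls_const (real k)" for k by (simp add: fls_of_nat)
  have "(\<Sum>i=0..Suc N. fls_const (d i) * F ^ (i + 1)) =
      (\<Sum>i=0..Suc N. fls_const (if i = 0 then 0 else real i * c (i - 1)) * F ^ (i + 1)) +
      (\<Sum>i=0..Suc N. fls_const ((real N + real (i + 1) * lam) * c i) * F ^ (i + 1))"
    by (simp only: d_def fls_plus_const[symmetric] distrib_right sum.distrib)
  also have "(\<Sum>i=0..Suc N. fls_const (if i = 0 then 0 else real i * c (i - 1)) * F ^ (i + 1)) =
      (\<Sum>i=0..N. fls_const (real (i + 1) * c i) * F ^ (i + 2))"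
    by (subst sum.atLeast0_atMost_Suc_shift) simp
  also have "(\<Sum>i=0..Suc N. fls_const ((real N + real (i + 1) * lam) * c i) * F ^ (i + 1)) =
      (\<Sum>i=0..N. fls_const ((real N + real (i + 1) * lam) * c i) * F ^ (i + 1))"
    by (simp add: c_top)
  also have "(\<Sum>i=0..N. fls_const (real (i + 1) * c i) * F ^ (i + 2)) + \<dots> =
      of_nat N * S + (\<Sum>i=0..N. fls_const (c i) * of_nat (i + 1) *
      (fls_const lam * F ^ (i + 1) + F ^ (i + 2)))"
    unfolding S_def sum_distrib_left sum.distrib[symmetric] cst
    by (intro sum.cong refl)
      (simp only: fls_plus_const[symmetric] fls_const_mult_const[symmetric] algebra_simps)
  finally have sum_d: "(\<Sum>i=0..Suc N. fls_const (d i) * F ^ (i + 1)) = \<dots>" .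
  have "(fls_deriv ^^ Suc N) F = fls_deriv (U ^ N * S)"
    using c by (simp add: is_F_deriv_coeffs_def U_def F_def S_def)
  also have "\<dots> = U ^ N * fls_deriv S + of_nat N * U ^ (N + 1) * S"
    by (simp add: dUN)
  also have "\<dots> = U ^ Suc N * (\<Sum>i=0..Suc N. fls_const (d i) * F ^ (i + 1))"
    unfolding sum_d dS by (simp add: distrib_left mult_ac)
  finally have "is_F_deriv_coeffs lam (Suc N) d"
    using c by (auto simp: is_F_deriv_coeffs_def U_def F_def d_def)
  thus ?case by blast
qed

lemma ex1_F_deriv_coeffs:
  assumes "lam \<noteq> 0"
  shows "\<exists>!c. is_F_deriv_coeffs lam N c"
proof (rule ex_ex1I[OF ex_F_deriv_coeffs[OF assms]])
  fix c d assume c: "is_F_deriv_coeffs lam N c" and d: "is_F_deriv_coeffs lam N d"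
  have "(- 1 / (1 + fls_X) :: real fls) ^ N \<noteq> 0"
    using one_plus_fls_X_nonzero by simp
  hence "(\<Sum>i=0..N. fls_const (c i) * F_series lam ^ (i + 1)) =
      (\<Sum>i=0..N. fls_const (d i) * F_series lam ^ (i + 1))"
    using c d one_plus_fls_X_nonzero unfolding is_F_deriv_coeffs_def by auto
  hence "(\<Sum>i=0..N. fls_const (c i - d i) * F_series lam ^ (i + 1)) = 0"
    by (simp only: fls_minus_const[symmetric] left_diff_distrib sum_subtractf right_minus_eq)
  from F_series_powers_independent[OF assms this] have "c i = d i" if "i \<le> N" for i
    using that by simp
  moreover have "c i = d i" if "i > N" for i
    using c d that by (simp add: is_F_deriv_coeffs_def)
  ultimately show "c = d" by (meson ext not_le)
qed

lemma a_coeff_0_0: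
  assumes "lam \<noteq> 0"
  shows "a_coeff lam 0 0 = 1"
proof -
  have "is_F_deriv_coeffs lam 0 (\<lambda>i. if i = 0 then 1 else 0)"
    by (simp add: is_F_deriv_coeffs_def)
  hence "a_coeff lam 0 = (\<lambda>i. if i = 0 then 1 else 0)"
    unfolding a_coeff_def by (rule the1_equality[OF ex1_F_deriv_coeffs[OF assms]])
  thus ?thesis by simp
qed

end

theory Submission
  imports Defs
begin

text \<open>
  Since \<open>\<Sum>\<^sub>n b\<^sub>n t\<^sup>n / n! = t F(t)\<close>, the number \<open>b\<^sub>j\<^sub>+\<^sub>N\<close> is \<open>j!\<close> times the coefficient of \<open>t\<^sup>j\<close> in
  \<open>(t F)\<^sup>(\<^sup>N\<^sup>) = t F\<^sup>(\<^sup>N\<^sup>) + N F\<^sup>(\<^sup>N\<^sup>-\<^sup>1\<^sup>)\<close>. Expand both derivatives in powers of \<open>F\<close> and pull out the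
  common factor \<open>(1 + t)\<^sup>-\<^sup>N\<close>, which leaves a factor \<open>1 + t\<close> in the second summand. The three double
  sums are the Cauchy products of \<open>(1 + t)\<^sup>-\<^sup>N\<close> with the Laurent series multiplying it.
\<close>

lemma fls_nth_fls_X_times [simp]:
  fixes f :: "'a :: comm_semiring_1 fls"
  shows "fls_nth (fls_X * f) n = fls_nth f (n - 1)"
  by (simp add: fls_X_times_conv_shift)

lemma fls_nth_fls_X_power_times:
  fixes f :: "'a :: comm_semiring_1 fls"
  shows "fls_nth (fls_X ^ k * f) n = fls_nth f (n - int k)"
  by (simp add: fls_X_power_times_conv_shift)

lemma fls_nth_higher_deriv:
  fixes f :: "'a :: field_char_0 fls"
  shows "fls_nth ((fls_deriv ^^ k) f) (int n) = fact (n + k) / fact n * fls_nth f (int (n + k))"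
proof (induction k arbitrary: n)
  case (Suc k)
  have "fls_nth ((fls_deriv ^^ Suc k) f) (int n) =
      of_nat (Suc n) * fls_nth ((fls_deriv ^^ k) f) (int (Suc n))"
    by (simp add: algebra_simps)
  thus ?case
    unfolding Suc by (simp add: field_simps del: of_nat_Suc)
qed simp

text \<open>Leibniz rule: only two terms survive, because the second derivative of t is 0.\<close>

lemma fls_higher_deriv_fls_X_times:
  fixes f :: "'a :: comm_ring_1 fls"
  shows "(fls_deriv ^^ Suc k) (fls_X * f) =
    fls_X * (fls_deriv ^^ Suc k) f + of_nat (Suc k) * (fls_deriv ^^ k) f"
  by (induction k) (simp_all add: algebra_simps)

text \<open>Any lower bound \<open>m\<close> for the order of \<open>f\<close> may start the sum.
  The exact order of the series used later depends on which coefficients vanish, whereas the limits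
  in the theorem are fixed.\<close>

lemma fls_nth_times_fps_to_fls:
  fixes f :: "'a :: comm_semiring_0 fls"
  assumes "\<And>l. l < m \<Longrightarrow> fls_nth f l = 0"
  shows "fls_nth (f * fps_to_fls g) n = (\<Sum>l=m..n. fls_nth f l * fps_nth g (nat (n - l)))"
proof (cases "f = 0")
  case False
  have "m \<le> fls_subdegree f"
    using False assms nth_fls_subdegree_nonzero[of f] by (meson not_le)
  hence "(\<Sum>l=fls_subdegree f..n - fls_subdegree (fps_to_fls g).
        fls_nth f l * fls_nth (fps_to_fls g) (n - l)) =
      (\<Sum>l=m..n. fls_nth f l * fls_nth (fps_to_fls g) (n - l))"
    using fls_subdegree_fls_to_fps_gt0[of g] fls_eq0_below_subdegree[of _ "fps_to_fls g"]
    by (intro sum.mono_neutral_left)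
      (auto simp del: fps_to_fls_nth simp: not_le)
  thus ?thesis
    by (simp add: fls_times_nth(2))
qed simp

lemma inverse_one_plus_fls_X_power:
  "inverse (1 + fls_X :: 'a :: field_char_0 fls) ^ N = fps_to_fls (fps_binomial (- of_nat N))"
  by (simp add: fps_binomial_minus_of_nat fls_inverse_fps_to_fls[symmetric] fps_to_fls_power
      subdegree_eq_0_iff power_inverse)

lemma gbinomial_minus_of_nat:
  assumes "N \<ge> 1"
  shows "(- of_nat N :: 'a :: field_char_0) gchoose k = (- 1) ^ k * of_nat ((N + k - 1) choose k)"
  using assms by (simp add: gbinomial_minus binomial_gbinomial of_nat_diff)

text \<open>The index \<open>l\<close> may be negative, hence the integer power. As -1 is its own
  inverse, \<open>l\<close> can be replaced by \<open>- l\<close>, which makes the exponent a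
  natural number.\<close>

lemma minus_one_powi_add_eq:
  assumes "l \<le> j"
  shows "(- 1 :: 'a :: field) powi (int N + j + l) = (- 1) ^ N * (- 1) ^ nat (j - l)"
proof -
  have "(- 1 :: 'a) powi (int N + j + l) = (- 1) powi (int N + j) * (- 1) powi (- l)"
    by (simp add: power_int_add power_int_minus_one_minus)
  also have "\<dots> = (- 1) powi (int N + int (nat (j - l)))"
    using assms by (simp add: add_diff_eq flip: power_int_add)
  also have "\<dots> = (- 1) ^ N * (- 1) ^ nat (j - l)"
    by (simp only: power_int_of_nat power_add flip: of_nat_add)
  finally show ?thesis .
qed

lemma fls_X_times_F_series:
  assumes "lam \<noteq> 0"
  shows "fls_X * F_series lam =
    fps_to_fls (fps_const lam * fps_X / (fps_binomial lam - 1))" (is "_ = fps_to_fls ?B")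
proof -
  have "fps_to_fls ?B * (fps_to_fls (fps_binomial lam) - 1) = fps_to_fls (?B * (fps_binomial lam - 1))"
    by (simp add: fls_times_fps_to_fls)
  also have "\<dots> = fls_const lam * fls_X"
    unfolding degenerate_bernoulli2_base[OF assms] by (simp add: fls_times_fps_to_fls)
  finally show ?thesis
    using binomial_series_minus_1_nonzero[OF assms] by (simp add: F_series_def field_simps)
qed

text \<open>Write F^r as t^(-r) (t F)^r, where t F is a power series. The case split is essential:
  below the pole order, \<open>nat\<close> would wrongly select the constant term.\<close>

lemma fls_nth_F_series_power:
  assumes "lam \<noteq> 0"
  shows "fls_nth (F_series lam ^ r) l =
    (if l < - int r then 0
     else degenerate_bernoulli2 lam r (nat (l + int r)) / fact (nat (l + int r)))"
proof -
  have "fls_nth (F_series lam ^ r) l = fls_nth ((fls_X * F_series lam) ^ r) (l + int r)"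
    by (simp add: power_mult_distrib fls_nth_fls_X_power_times)
  thus ?thesis
    by (simp add: fls_X_times_F_series[OF assms] degenerate_bernoulli2_def flip: fps_to_fls_power)
qed

text \<open>What is left of the \<open>N\<close>-th derivative of F after removing the power of
  -1/(1 + t).\<close>

definition F_poly :: "real \<Rightarrow> nat \<Rightarrow> real fls" where
  "F_poly lam N = (\<Sum>i=0..N. fls_const (a_coeff lam N i) * F_series lam ^ (i + 1))"

lemma fls_higher_deriv_F_series:
  assumes "lam \<noteq> 0"
  shows "(fls_deriv ^^ N) (F_series lam) = (- 1) ^ N * (inverse (1 + fls_X) ^ N * F_poly lam N)"
proof -
  have "is_F_deriv_coeffs lam N (a_coeff lam N)"
    unfolding a_coeff_def by (rule theI'[OF ex1_F_deriv_coeffs[OF assms]])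
  moreover have "(- 1 / (1 + fls_X) :: real fls) = - 1 * inverse (1 + fls_X)"
    by (simp add: divide_inverse)
  ultimately show ?thesis
    by (simp only: is_F_deriv_coeffs_def F_poly_def power_mult_distrib mult.assoc)
qed

text \<open>F^(i+1) has a pole of order i + 1, so it reaches t^l only if i \<ge> -l - 1. For l < -N
  - 1 the range is empty, which also bounds the pole order by N + 1.\<close>

lemma fls_nth_F_poly:
  assumes "lam \<noteq> 0"
  shows "fls_nth (F_poly lam N) l =
    (\<Sum>i = nat (max 0 (- l - 1))..N. a_coeff lam N i *
      (degenerate_bernoulli2 lam (i + 1) (nat (l + int i + 1)) / fact (nat (l + int i + 1))))"
proof -
  have "fls_nth (F_poly lam N) l =
      (\<Sum>i=0..N. a_coeff lam N i * fls_nth (F_series lam ^ (i + 1)) l)"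
    by (simp only: F_poly_def fls_nth_sum fls_mult_const_nth(1))
  also have "\<dots> = (\<Sum>i = nat (max 0 (- l - 1))..N.
      a_coeff lam N i * fls_nth (F_series lam ^ (i + 1)) l)"
    unfolding fls_nth_F_series_power[OF assms] by (intro sum.mono_neutral_right) auto
  also have "\<dots> = (\<Sum>i = nat (max 0 (- l - 1))..N. a_coeff lam N i *
      (degenerate_bernoulli2 lam (i + 1) (nat (l + int i + 1)) / fact (nat (l + int i + 1))))"
    unfolding fls_nth_F_series_power[OF assms]
    by (intro sum.cong refl) (auto simp: algebra_simps)
  finally show ?thesis .
qed

text \<open>The sign exponent \<open>M\<close> is kept apart from \<open>N\<close>, since the
  theorem pairs the same power of 1/(1 + t) with both signs.\<close>

lemma fls_nth_inverse_one_plus_fls_X_power_times: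
  fixes f :: "real fls"
  assumes "N \<ge> 1" and "\<And>l. l < m \<Longrightarrow> fls_nth f l = 0"
  shows "fls_nth ((- 1) ^ M * (inverse (1 + fls_X) ^ N * f)) (int j) =
    (\<Sum>l=m..int j. (- 1) powi (int M + int j + l)
      * real (nat (int N + int j - l - 1) choose nat (int j - l)) * fls_nth f l)"
proof -
  have "fls_nth ((- 1) ^ M * (inverse (1 + fls_X) ^ N * f)) (int j) =
      (- 1) ^ M * fls_nth (f * fps_to_fls (fps_binomial (- of_nat N))) (int j)"
    by (cases "even M") (simp_all add: inverse_one_plus_fls_X_power mult.commute)
  also have "\<dots> = (\<Sum>l=m..int j. (- 1) ^ M *
      (fls_nth f l * ((- 1) ^ nat (int j - l) * real ((N + nat (int j - l) - 1) choose nat (int j - l)))))"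
    using assms(1)
    by (simp add: fls_nth_times_fps_to_fls[OF assms(2)] sum_distrib_left gbinomial_minus_of_nat)
  also have "\<dots> = (\<Sum>l=m..int j. (- 1) powi (int M + int j + l)
      * real (nat (int N + int j - l - 1) choose nat (int j - l)) * fls_nth f l)"
  proof (intro sum.cong refl)
    fix l assume "l \<in> {m..int j}"
    hence "l \<le> int j" by simp
    moreover from this have "N + nat (int j - l) - 1 = nat (int N + int j - l - 1)"
      using assms(1) by linarith
    ultimately show "(- 1) ^ M * (fls_nth f l * ((- 1) ^ nat (int j - l)
          * real ((N + nat (int j - l) - 1) choose nat (int j - l)))) =
        (- 1) powi (int M + int j + l)
          * real (nat (int N + int j - l - 1) choose nat (int j - l)) * fls_nth f l"
      by (simp add: minus_one_powi_add_eq)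
  qed
  finally show ?thesis .
qed

theorem theorem4p1:
  fixes lam :: real and j N :: nat
  assumes "lam \<noteq> 0" and "N \<ge> 1"
  shows "degenerate_bernoulli2 lam 1 (j + N) =
      (\<Sum>l = - int N..int j. \<Sum>i = nat (max 0 (- l))..N.
         (- 1) powi (int N + int j + l)
         * real (nat (int N + int j - l - 1) choose nat (int j - l))
         * a_coeff lam N i * degenerate_bernoulli2 lam (i + 1) (nat (l + int i))
         * (fact j / fact (nat (l + int i))))
    + (\<Sum>l = - int N..int j. \<Sum>i = nat (max 0 (- l - 1))..N - 1.
         real N * (- 1) powi (int N + int j + l + 1)
         * real (nat (int N + int j - l - 1) choose nat (int j - l))
         * a_coeff lam (N - 1) i * degenerate_bernoulli2 lam (i + 1) (nat (l + int i + 1))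
         * (fact j / fact (nat (l + int i + 1))))
    + (\<Sum>l = - (int N - 1)..int j. \<Sum>i = nat (max 0 (- l))..N - 1.
         real N * (- 1) powi (int N + int j + l + 1)
         * real (nat (int N + int j - l - 1) choose nat (int j - l))
         * a_coeff lam (N - 1) i * degenerate_bernoulli2 lam (i + 1) (nat (l + int i))
         * (fact j / fact (nat (l + int i))))"
proof -
  define W :: "real fls" where "W = inverse (1 + fls_X)"
  define P where "P = F_poly lam N"
  define Q where "Q = F_poly lam (N - 1)"
  define k where "k = (\<lambda>M l. (- 1 :: real) powi (int M + int j + l)
      * real (nat (int N + int j - l - 1) choose nat (int j - l)))"
  have N: "Suc (N - 1) = N" using assms(2) by simp
  have W: "W * (1 + fls_X) = 1"
    using one_plus_fls_X_nonzero by (simp add: W_def)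
  \<comment> \<open>The summands 1 and t of this extra factor produce the second and the third
    double sum.\<close>
  have "W ^ (N - 1) = W ^ N * (1 + fls_X)"
    using W by (subst N[symmetric]) (simp add: mult_ac)
  hence Q: "W ^ (N - 1) * Q = W ^ N * Q + W ^ N * (fls_X * Q)"
    by (simp add: algebra_simps)
  have sign: "(- 1 :: real fls) ^ (N - 1) = (- 1) ^ (N + 1)"
    by (subst (2) N[symmetric]) simp
  \<comment> \<open>Differentiating yields the factor (j + N)!/j!, which turns the normalisation (j
    + N)! into j!.\<close>
  have "degenerate_bernoulli2 lam 1 (j + N) =
      fact j * fls_nth ((fls_deriv ^^ N) (fls_X * F_series lam)) (int j)"
    by (simp only: fls_nth_higher_deriv fls_X_times_F_series[OF assms(1)])
      (simp add: degenerate_bernoulli2_def nat_add_distrib)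
  also have "(fls_deriv ^^ N) (fls_X * F_series lam) =
      fls_X * (fls_deriv ^^ N) (F_series lam) + of_nat N * (fls_deriv ^^ (N - 1)) (F_series lam)"
    using fls_higher_deriv_fls_X_times[of "N - 1" "F_series lam"] by (simp only: N)
  also have "\<dots> = (- 1) ^ N * (W ^ N * (fls_X * P))
      + fls_const (real N) * ((- 1) ^ (N + 1) * (W ^ N * Q))
      + fls_const (real N) * ((- 1) ^ (N + 1) * (W ^ N * (fls_X * Q)))"
    unfolding fls_higher_deriv_F_series[OF assms(1)] W_def[symmetric] P_def[symmetric]
      Q_def[symmetric] Q sign fls_of_nat by (simp only: distrib_left mult_ac add.assoc)
  also have "fact j * fls_nth \<dots> (int j) =
      fact j * fls_nth ((- 1) ^ N * (W ^ N * (fls_X * P))) (int j)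
      + fact j * (real N * fls_nth ((- 1) ^ (N + 1) * (W ^ N * Q)) (int j))
      + fact j * (real N * fls_nth ((- 1) ^ (N + 1) * (W ^ N * (fls_X * Q))) (int j))"
    by (simp only: fls_plus_nth fls_mult_const_nth(1) distrib_left)
  \<comment> \<open>The pole orders of t P, Q and t Q are at most N, N and N - 1; these give the
    three lower limits for \<open>l\<close>.\<close>
  also have "fls_nth ((- 1) ^ N * (W ^ N * (fls_X * P))) (int j) =
      (\<Sum>l = - int N..int j. k N l * fls_nth (fls_X * P) l)"
    unfolding W_def k_def using assms
    by (intro fls_nth_inverse_one_plus_fls_X_power_times) (auto simp: P_def fls_nth_F_poly)
  also have "fls_nth ((- 1) ^ (N + 1) * (W ^ N * Q)) (int j) =
      (\<Sum>l = - int N..int j. k (N + 1) l * fls_nth Q l)"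
    unfolding W_def k_def using assms
    by (intro fls_nth_inverse_one_plus_fls_X_power_times) (auto simp: Q_def fls_nth_F_poly)
  also have "fls_nth ((- 1) ^ (N + 1) * (W ^ N * (fls_X * Q))) (int j) =
      (\<Sum>l = - (int N - 1)..int j. k (N + 1) l * fls_nth (fls_X * Q) l)"
    unfolding W_def k_def using assms
    by (intro fls_nth_inverse_one_plus_fls_X_power_times) (auto simp: Q_def fls_nth_F_poly)
  finally show ?thesis
    by (simp add: P_def Q_def k_def fls_nth_F_poly[OF assms(1)] sum_distrib_left
        algebra_simps)
qed

end
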